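(* Let $G$ be a connected graph on $n\ge 2$ vertices and let $h_G$ be the Cheeger constant of its normalized distance Laplacian, i.e. $h_G=\min_{S} h(S)$ over nonempty proper subsets $S\subsetneq V(G)$. (i) If $n$ is even, then $h_G \geq \frac{n}{3n-4}$, with equality if and only if $G$ is isomorphic to the complete bipartite graph $K_{n/2,n/2}$. (ii) If $n$ is odd, then $h_G\geq \frac{n+1}{3n-5}$. Moreover, if $n$ is odd and $n\neq 5$, equality holds if and only if $G$ is isomorphic to a graph obtained from the complete bipartite graph $K_{\lfloor n/2\rfloor,\lceil n/2\rceil}$ by adding at most $n-1$ edges (possibly none), each having both endpoints in the larger part (the part with $\lceil n/2\rceil$ vertices).
   Context: Graphs are finite, simple and undirected. For a connected graph $G$, $d(u,v)$ denotes the shortest-path distance between vertices $u,v$, and the transmission of a vertex $u$ is $t(u)=\sum_{v\in V(G)}d(u,v)$. For $S\subseteq V(G)$ write $\overline S=V(G)\setminus S$ and $\operatorname{vol} S=\sum_{u\in S}t(u)$. For a nonempty proper subset $S\subsetneq V(G)$ define $$h(S)=\frac{\sum_{u\in S,\,v\in\overline S}d(u,v)}{\min\{\operatorname{vol} S,\operatorname{vol}\overline S\}}.$$ The Cheeger constant is $h_G=\min h(S)$ over all nonempty proper subsets $S$ of $V(G)$. *)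

theory Defs
  imports
    "Graph_Theory.Shortest_Path"
    "Graph_Theory.Pair_Digraph"
    "Graph_Theory.Digraph_Isomorphism"
    "Graph_Theory.Kuratowski"
begin

(* A finite simple undirected graph is a pair_graph: an edge uv is represented by
   the two arcs (u,v) and (v,u). *)

(* Every arc has weight 1, so awalk_cost counts arcs.  On a connected graph the
   value of \<mu> is finite and real_of_ereal loses nothing. *)
definition gdist :: "'a pair_pre_digraph \<Rightarrow> 'a \<Rightarrow> 'a \<Rightarrow> real" where
  "gdist G u v = real_of_ereal (wf_digraph.\<mu> (with_proj G) (\<lambda>_. 1) u v)"

definition transmission :: "'a pair_pre_digraph \<Rightarrow> 'a \<Rightarrow> real" where
  "transmission G u = (\<Sum>v\<in>pverts G. gdist G u v)"

definition vol :: "'a pair_pre_digraph \<Rightarrow> 'a set \<Rightarrow> real" where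
  "vol G S = (\<Sum>u\<in>S. transmission G u)"

definition cheeger_ratio :: "'a pair_pre_digraph \<Rightarrow> 'a set \<Rightarrow> real" where
  "cheeger_ratio G S =
     (\<Sum>u\<in>S. \<Sum>v\<in>pverts G - S. gdist G u v) / min (vol G S) (vol G (pverts G - S))"

definition cheeger_constant :: "'a pair_pre_digraph \<Rightarrow> real" where
  "cheeger_constant G = Min (cheeger_ratio G ` {S. S \<noteq> {} \<and> S \<subset> pverts G})"

definition complete_bipartite :: "nat \<Rightarrow> nat \<Rightarrow> (nat + nat) pair_pre_digraph" where
  "complete_bipartite a b =
     (let U = Inl ` {..<a}; W = Inr ` {..<b}
      in \<lparr>pverts = U \<union> W, parcs = U \<times> W \<union> W \<times> U\<rparr>)"

lemma complete_bipartite_digraph_complete_bipartite: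
  "complete_bipartite_digraph a b (with_proj (complete_bipartite a b))"
  unfolding complete_bipartite_digraph_pair_def
  by (intro conjI exI[of _ "Inl ` {..<a}"] exI[of _ "Inr ` {..<b}"])
     (auto simp: complete_bipartite_def Let_def card_image)

(* F is a set of undirected edges, each a set of two vertices. *)
definition add_edges :: "'a pair_pre_digraph \<Rightarrow> 'a set set \<Rightarrow> 'a pair_pre_digraph" where
  "add_edges G F = G\<lparr>parcs := parcs G \<union> {(u, v). {u, v} \<in> F}\<rparr>"

definition isomorphic :: "'a pair_pre_digraph \<Rightarrow> 'b pair_pre_digraph \<Rightarrow> bool" where
  "isomorphic G H \<longleftrightarrow> digraph_iso (with_proj G) (with_proj H)"

end

theory Submission
  imports Defs
begin

text \<open>
  Let $D$ be the sum of the distances across a cut $(S, \overline S)$ and $I(S)$ the sum of the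
  distances within $S$ over ordered pairs, so that $h(S) = D / (D + \min(I(S), I(\overline S)))$.
  Adding up the triangle inequalities $d(u,u') \le d(u,v) + d(u',v)$ over distinct $u, u' \in S$ and
  $v \in \overline S$ gives $|\overline S| \, I(S) \le 2 (|S| - 1) D$. If $S$ is the smaller side,
  then with $a = \lfloor n/2 \rfloor$ and $b = \lceil n/2 \rceil$ this is $b \, I(S) \le 2 (a - 1) D$,
  whence $h(S) \ge b / (b + 2a - 2)$ for either parity of $n$.

  Equality forces $|S| = a$ and all these triangles to be tight (on both sides if $n$ is even). Then $S$
  is independent, and if $n$ is even or $a \ge 3$, the first step of a shortest path from $u \in S$ to
  $v \in \overline S$ shows that $u$ and $v$ are adjacent, so $G$ is $K_{a,b}$ plus $e$ edges within
  the larger part. Conversely such a graph attains the bound iff $I(S) \le I(\overline S)$, that is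
  $e \le (b - a)(n - 1)$. The case $n = 3$, where there are no triangles to exploit, is settled by a
  dominating vertex.
\<close>

section \<open>Isomorphisms of pair graphs and the shape of a join\<close>

lemma isomorphic_iff:
  assumes "pair_wf_digraph G"
  shows "isomorphic G H \<longleftrightarrow>
    (\<exists>f. inj_on f (pverts G) \<and> pverts H = f ` pverts G \<and> parcs H = map_prod f f ` parcs G)"
    (is "?L \<longleftrightarrow> ?R")
proof -
  interpret pair_wf_digraph G by fact
  show ?thesis
  proof
    assume ?L
    then obtain h where h: "digraph_isomorphism h" "with_proj H = app_iso h (with_proj G)"
      unfolding isomorphic_def digraph_iso_def by blast
    have "pverts H = iso_verts h ` pverts G"
      using arg_cong[OF h(2), of verts] by simp
    \<comment> \<open>Both digraphs have \<open>fst\<close> and \<open>snd\<close> as tail and head,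
      so the arc map of an isomorphism is forced by its vertex map.\<close>
    moreover have "iso_arcs h e = map_prod (iso_verts h) (iso_verts h) e" if "e \<in> parcs G" for e
      using iso_verts_tail[OF h(1), of e] iso_verts_head[OF h(1), of e] that
        arg_cong[OF h(2), of tail] arg_cong[OF h(2), of head]
      by (auto simp: prod_eq_iff)
    then have "parcs H = map_prod (iso_verts h) (iso_verts h) ` parcs G"
      using arg_cong[OF h(2), of arcs] by simp
    moreover have "inj_on (iso_verts h) (pverts G)"
      using digraph_isomorphism_inj_on_verts[OF h(1)] by simp
    ultimately show ?R by blast
  next
    assume ?R
    then obtain f where f: "inj_on f (pverts G)" "pverts H = f ` pverts G"
      "parcs H = map_prod f f ` parcs G" by blast
    define h where "h = \<lparr>iso_verts = f, iso_arcs = map_prod f f, iso_head = snd, iso_tail = fst\<rparr>"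
    have "inj_on (map_prod f f) (parcs G)"
      by (rule inj_on_subset[OF map_prod_inj_on[OF f(1) f(1)]]) (auto dest: wellformed')
    then have "digraph_isomorphism h"
      using f(1) wf_digraph_axioms unfolding digraph_isomorphism_def by (auto simp: h_def)
    moreover have "with_proj H = app_iso h (with_proj G)"
      using f by (simp add: app_iso_def h_def with_proj_def)
    ultimately show ?L unfolding isomorphic_def digraph_iso_def by blast
  qed
qed

text \<open>A two-element set has exactly two orderings, and distinct sets share none. This passes
  between counts of undirected edges and counts of arcs.\<close>

lemma
  assumes "finite F" "\<And>e. e \<in> F \<Longrightarrow> card e = 2"
  shows finite_pairs_of_edges: "finite {(u, v). {u, v} \<in> F}"
    and card_pairs_of_edges: "card {(u, v). {u, v} \<in> F} = 2 * card F"
proof -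
  have fibre: "finite {(u, v). {u, v} = e} \<and> card {(u, v). {u, v} = e} = 2"
    if e: "card e = 2" for e :: "'a set"
  proof -
    obtain x y where xy: "e = {x, y}" "x \<noteq> y"
      using e by (meson card_2_iff)
    then have "{(u, v). {u, v} = e} = {(x, y), (y, x)}"
      by (auto simp: doubleton_eq_iff)
    then show ?thesis using xy by simp
  qed
  have union: "{(u, v). {u, v} \<in> F} = (\<Union>e\<in>F. {(u, v). {u, v} = e})" by blast
  show "finite {(u, v). {u, v} \<in> F}"
    unfolding union using assms fibre by blast
  have "card {(u, v). {u, v} \<in> F} = (\<Sum>e\<in>F. card {(u, v). {u, v} = e})"
    unfolding union using assms fibre by (simp add: card_UN_disjoint disjoint_iff)
  also have "\<dots> = 2 * card F" using assms fibre by simp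
  finally show "card {(u, v). {u, v} \<in> F} = 2 * card F" .
qed

text \<open>Replaces an isomorphism onto a complete bipartite graph with added edges by a
  bipartition inside \<open>G\<close>, with \<open>S\<close> in the role of the left part. The
  factor 2 appears because each added edge amounts to two arcs.\<close>

lemma isomorphic_join_iff:
  assumes "pair_graph G"
  shows "(\<exists>F. F \<subseteq> {e. e \<subseteq> Inr ` {..<b} \<and> card e = 2} \<and> card F \<le> k \<and>
            isomorphic G (add_edges (complete_bipartite a b) F)) \<longleftrightarrow>
         (\<exists>S\<subseteq>pverts G. card S = a \<and> card (pverts G - S) = b \<and> S \<times> S \<inter> parcs G = {} \<and>
            S \<times> (pverts G - S) \<subseteq> parcs G \<and>
            card ((pverts G - S) \<times> (pverts G - S) \<inter> parcs G) \<le> 2 * k)"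
    (is "?L \<longleftrightarrow> ?R")
proof -
  interpret pair_graph G by fact
  note iso = isomorphic_iff[OF pair_wf_digraph]
  show ?thesis
  proof
    assume ?L
    then obtain F where F: "F \<subseteq> {e. e \<subseteq> Inr ` {..<b} \<and> card e = 2}" "card F \<le> k"
      and F_iso: "isomorphic G (add_edges (complete_bipartite a b) F)" by blast
    obtain f where inj: "inj_on f (pverts G)"
      and verts: "f ` pverts G = Inl ` {..<a} \<union> Inr ` {..<b}"
      and arcs: "map_prod f f ` parcs G =
        Inl ` {..<a} \<times> Inr ` {..<b} \<union> Inr ` {..<b} \<times> Inl ` {..<a} \<union> {(x, y). {x, y} \<in> F}"
      using F_iso unfolding iso add_edges_def complete_bipartite_def Let_def by auto
    have fin_F: "finite F"
      by (rule finite_subset[of _ "Pow (Inr ` {..<b})"]) (use F in auto)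
    define S where "S = pverts G \<inter> f -` Inl ` {..<a}"
    have S: "S \<subseteq> pverts G" by (auto simp: S_def)
    have "f ` (A \<inter> f -` B) = f ` A \<inter> B" for A B by blast
    then have "f ` S = f ` pverts G \<inter> Inl ` {..<a}" unfolding S_def .
    then have image_S: "f ` S = Inl ` {..<a}" unfolding verts by auto
    have "f ` (pverts G - S) = f ` pverts G - f ` S"
      using S by (intro inj_on_image_set_diff[OF inj]) auto
    then have image_T: "f ` (pverts G - S) = Inr ` {..<b}"
      unfolding image_S verts by auto
    have arc_iff: "(u, v) \<in> parcs G \<longleftrightarrow> (f u, f v) \<in> map_prod f f ` parcs G"
      if "u \<in> pverts G" "v \<in> pverts G" for u v
      using that inj by (auto dest: inj_onD wellformed')
    have "card S = card (f ` S)" "card (pverts G - S) = card (f ` (pverts G - S))"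
      using S inj by (auto intro!: card_image[symmetric] inj_on_subset[OF inj])
    then have "card S = a" "card (pverts G - S) = b"
      unfolding image_S image_T by (simp_all add: card_image)
    moreover have "(u, v) \<notin> parcs G" if "u \<in> S" "v \<in> S" for u v
    proof -
      have "f u \<in> range Inl" "f v \<in> range Inl" using that by (auto simp: S_def)
      then have "(f u, f v) \<notin> map_prod f f ` parcs G"
        unfolding arcs by (auto dest!: subsetD[OF F(1)])
      then show ?thesis by (auto simp: image_iff)
    qed
    then have "S \<times> S \<inter> parcs G = {}" by auto
    moreover have "S \<times> (pverts G - S) \<subseteq> parcs G"
    proof safe
      fix u v assume uv: "u \<in> S" "v \<in> pverts G" "v \<notin> S"
      then have "f u \<in> Inl ` {..<a}" "f v \<in> Inr ` {..<b}" using image_S image_T by auto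
      then show "(u, v) \<in> parcs G" using uv S by (simp add: arc_iff arcs subset_iff)
    qed
    moreover have "card ((pverts G - S) \<times> (pverts G - S) \<inter> parcs G) \<le> 2 * k"
    proof -
      have "map_prod f f ` ((pverts G - S) \<times> (pverts G - S) \<inter> parcs G) \<subseteq> {(x, y). {x, y} \<in> F}"
      proof safe
        fix u v assume uv: "u \<in> pverts G" "u \<notin> S" "v \<in> pverts G" "v \<notin> S" "(u, v) \<in> parcs G"
        then have "(f u, f v) \<in> map_prod f f ` parcs G" by auto
        moreover have "f u \<in> Inr ` {..<b}" "f v \<in> Inr ` {..<b}" using uv image_T by auto
        ultimately show "{f u, f v} \<in> F" unfolding arcs by auto
      qed
      moreover have "finite {(x, y). {x, y} \<in> F}"
        using F(1) by (intro finite_pairs_of_edges fin_F) auto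
      ultimately have "card (map_prod f f ` ((pverts G - S) \<times> (pverts G - S) \<inter> parcs G))
          \<le> card {(x, y). {x, y} \<in> F}"
        by (rule card_mono[rotated])
      also have "\<dots> = 2 * card F" using F(1) by (intro card_pairs_of_edges fin_F) auto
      finally have "card (map_prod f f ` ((pverts G - S) \<times> (pverts G - S) \<inter> parcs G)) \<le> 2 * card F" .
      moreover have "inj_on (map_prod f f) ((pverts G - S) \<times> (pverts G - S) \<inter> parcs G)"
        by (rule inj_on_subset[OF map_prod_inj_on[OF inj inj]]) auto
      ultimately show ?thesis using F(2) by (simp add: card_image)
    qed
    ultimately show ?R using S by blast
  next
    assume ?R
    then obtain S where S: "S \<subseteq> pverts G" "card S = a" "card (pverts G - S) = b"
      "S \<times> S \<inter> parcs G = {}" "S \<times> (pverts G - S) \<subseteq> parcs G"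
      "card ((pverts G - S) \<times> (pverts G - S) \<inter> parcs G) \<le> 2 * k" by blast
    define T where "T = pverts G - S"
    have V: "pverts G = S \<union> T" "S \<inter> T = {}" using S(1) by (auto simp: T_def)
    have "finite S" using S(1) finite_subset finite_verts by blast
    then obtain g where g: "bij_betw g S {..<a}"
      using S(2) ex_bij_betw_finite_nat lessThan_atLeast0 by metis
    obtain h where h: "bij_betw h T {..<b}"
      using S(3) ex_bij_betw_finite_nat lessThan_atLeast0 finite_verts finite_Diff T_def by metis
    define f where "f u = (if u \<in> S then Inl (g u) else Inr (h u))" for u
    have image_S: "f ` S = Inl ` {..<a}"
      using g unfolding f_def by (auto simp: bij_betw_def image_image)
    have image_T: "f ` T = Inr ` {..<b}"
    proof -
      have "f ` T = Inr ` h ` T" using V(2) by (auto simp: f_def image_image intro!: image_cong)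
      then show ?thesis using h by (simp add: bij_betw_def)
    qed
    have inj: "inj_on f (pverts G)"
      using g h V by (auto simp: inj_on_def f_def bij_betw_def)
    define A where "A = T \<times> T \<inter> parcs G"
    define F where "F = (\<lambda>(u, v). {f u, f v}) ` A"
    have A_sym: "(v, u) \<in> A" if "(u, v) \<in> A" for u v
      using that arcs_symmetric by (simp add: A_def)
    \<comment> \<open>An edge in \<open>F\<close> forgets its orientation. Symmetry of
      \<open>A\<close> supplies both arcs again, so reading \<open>F\<close> back as ordered pairs
      gains and loses nothing.\<close>
    have pairs: "{(x, y). {x, y} \<in> F} = map_prod f f ` A"
    proof (intro set_eqI iffI)
      fix p assume "p \<in> {(x, y). {x, y} \<in> F}"
      then obtain u v where "(u, v) \<in> A" "{fst p, snd p} = {f u, f v}"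
        by (auto simp: F_def)
      then have "(u, v) \<in> A" "(v, u) \<in> A" "p = map_prod f f (u, v) \<or> p = map_prod f f (v, u)"
        by (auto simp: doubleton_eq_iff prod_eq_iff A_sym)
      then show "p \<in> map_prod f f ` A" by blast
    qed (auto simp: F_def)
    have F: "F \<subseteq> {e. e \<subseteq> Inr ` {..<b} \<and> card e = 2}"
    proof -
      have "{f u, f v} \<in> {e. e \<subseteq> Inr ` {..<b} \<and> card e = 2}" if "(u, v) \<in> A" for u v
      proof -
        have uv: "u \<in> T" "v \<in> T" "u \<noteq> v" using that no_loops' by (auto simp: A_def)
        then have "f u \<noteq> f v" using V(1) by (simp add: inj_on_eq_iff[OF inj])
        moreover have "f u \<in> f ` T" "f v \<in> f ` T" using uv by auto
        ultimately show ?thesis unfolding image_T by simp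
      qed
      then show ?thesis unfolding F_def by fast
    qed
    have "finite A" by (simp add: A_def)
    then have "finite F" by (simp add: F_def)
    then have "2 * card F = card (map_prod f f ` A)"
      using F unfolding pairs[symmetric] by (intro card_pairs_of_edges[symmetric]) auto
    also have "\<dots> \<le> card A"
      using \<open>finite A\<close> by (rule card_image_le)
    finally have "2 * card F \<le> card A" .
    then have "card F \<le> k" using S(6) by (simp add: A_def T_def)
    moreover have "parcs G = S \<times> T \<union> T \<times> S \<union> A"
    proof
      have "p \<in> S \<times> T \<union> T \<times> S \<union> A" if "p \<in> parcs G" for p
        using that S(4) V(1) wellformed'[of "fst p" "snd p"] by (cases p) (auto simp: A_def)
      then show "parcs G \<subseteq> S \<times> T \<union> T \<times> S \<union> A" by blast
      have "S \<times> T \<subseteq> parcs G" using S(5) by (simp add: T_def)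
      then show "S \<times> T \<union> T \<times> S \<union> A \<subseteq> parcs G"
        using arcs_symmetric by (auto simp: A_def)
    qed
    then have "map_prod f f ` parcs G =
        Inl ` {..<a} \<times> Inr ` {..<b} \<union> Inr ` {..<b} \<times> Inl ` {..<a} \<union> {(x, y). {x, y} \<in> F}"
      unfolding pairs by (simp add: image_Un map_prod_surj_on[OF image_S image_T] map_prod_surj_on[OF image_T image_S])
    then have "isomorphic G (add_edges (complete_bipartite a b) F)"
      unfolding iso add_edges_def complete_bipartite_def Let_def
      using inj by (intro exI[of _ f]) (simp add: V(1) image_Un image_S image_T)
    ultimately show ?L using F by (intro exI[of _ F] conjI)
  qed
qed

section \<open>Distances in a connected graph\<close>

locale connected_pair_graph = pair_graph G for G :: "'a pair_pre_digraph" +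
  assumes connected_G: "Digraph_Component.connected (with_proj G)"
begin

abbreviation V where "V \<equiv> pverts G"
abbreviation d where "d \<equiv> gdist G"

lemma reachable_verts: "u \<in> V \<Longrightarrow> v \<in> V \<Longrightarrow> u \<rightarrow>\<^sup>*\<^bsub>with_proj G\<^esub> v"
  using symmetric_connected_imp_strongly_connected[OF sym_arcs connected_G]
  by auto

lemma awalk_cost_unit: "awalk_cost (\<lambda>_. 1) p = real (length p)"
  by (induction p) auto

lemma shortest_awalk:
  assumes "u \<in> V" "v \<in> V"
  obtains p where "awalk u p v" "d u v = length p"
proof -
  obtain p where "apath u p v" "\<mu> (\<lambda>_. 1) u v = awalk_cost (\<lambda>_. 1) p"
    using min_cost_awalk[OF reachable_verts[OF assms], of "\<lambda>_. 1"] by auto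
  then show ?thesis
    using that[of p] by (auto simp: gdist_def awalk_cost_unit dest: awalkI_apath)
qed

lemma gdist_le_length:
  assumes "awalk u p v" shows "d u v \<le> length p"
proof -
  have uv: "u \<in> V" "v \<in> V" using assms by auto
  obtain q where "apath u q v" "\<mu> (\<lambda>_. 1) u v = awalk_cost (\<lambda>_. 1) q"
    using min_cost_awalk[OF reachable_verts[OF uv], of "\<lambda>_. 1"] by auto
  then show ?thesis
    using min_cost_le_walk_cost[OF assms, of "\<lambda>_. 1"] by (simp add: gdist_def awalk_cost_unit)
qed

lemma gdist_triangle:
  assumes "u \<in> V" "v \<in> V" "w \<in> V"
  shows "d u w \<le> d u v + d v w"
proof -
  obtain p q where "awalk u p v" "d u v = length p" "awalk v q w" "d v w = length q"
    using shortest_awalk assms by metis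
  then show ?thesis
    using gdist_le_length[of u "p @ q" w] by (auto dest: awalk_appendI)
qed

lemma gdist_sym:
  assumes "u \<in> V" "v \<in> V"
  shows "d u v = d v u"
proof -
  have "d y x \<le> d x y" if xy: "x \<in> V" "y \<in> V" for x y
  proof -
    obtain p where p: "awalk x p y" "d x y = length p"
      using shortest_awalk xy by metis
    have "length (rev_path p) = length p" by (induction p) auto
    then show ?thesis using p gdist_le_length[of y "rev_path p" x] by simp
  qed
  then show ?thesis using assms by (auto intro: antisym)
qed

lemma gdist_self: "u \<in> V \<Longrightarrow> d u u = 0"
  by (rule shortest_awalk[of u u]) (use gdist_le_length[of u "[]" u] in \<open>auto simp: awalk_Nil_iff\<close>)

lemma gdist_ge_1: "u \<in> V \<Longrightarrow> v \<in> V \<Longrightarrow> u \<noteq> v \<Longrightarrow> 1 \<le> d u v"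
  by (rule shortest_awalk[of u v]) (auto simp: Suc_le_eq awalk_Nil_iff)

lemma gdist_adjacent:
  assumes "(u, v) \<in> parcs G" shows "d u v = 1"
proof -
  have "u \<in> V" "v \<in> V" "u \<noteq> v" using assms no_loops' by (auto dest: wellformed')
  moreover have "d u v \<le> length [(u, v)]"
    using \<open>v \<in> V\<close> assms by (intro gdist_le_length) (simp add: awalk_simps)
  ultimately show ?thesis using gdist_ge_1 by force
qed

text \<open>The first arc of a shortest walk leads to \<open>w\<close>. The rest of the walk bounds
  \<open>d w v\<close> from above, the triangle inequality from below.\<close>

lemma gdist_step:
  assumes "u \<in> V" "v \<in> V" "u \<noteq> v"
  obtains w where "(u, w) \<in> parcs G" "d w v = d u v - 1"
proof -
  obtain p where p: "awalk u p v" "d u v = length p"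
    using shortest_awalk assms by metis
  with \<open>u \<noteq> v\<close> obtain e q where eq: "p = e # q"
    by (cases p) (auto simp: awalk_Nil_iff)
  define w where "w = snd e"
  have arc: "(u, w) \<in> parcs G" and walk: "awalk w q v"
    using p eq by (auto simp: awalk_Cons_iff w_def)
  have "d w v \<le> d u v - 1" using gdist_le_length[OF walk] p eq by simp
  moreover have "d u v \<le> 1 + d w v"
    using gdist_triangle[of u w v] gdist_adjacent[OF arc] arc assms by (auto dest: wellformed')
  ultimately show ?thesis using that arc by simp
qed

text \<open>The first step towards \<open>v\<close> cannot already land on \<open>v\<close>, so at
  least one more step remains.\<close>

lemma gdist_not_adjacent:
  assumes "u \<in> V" "v \<in> V" "u \<noteq> v" "(u, v) \<notin> parcs G"
  shows "2 \<le> d u v"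
proof -
  obtain w where w: "(u, w) \<in> parcs G" "d w v = d u v - 1"
    using gdist_step assms by metis
  then have "1 \<le> d w v" using assms by (intro gdist_ge_1) (auto dest: wellformed')
  then show ?thesis using w by simp
qed

lemma gdist_common_neighbour:
  assumes "(u, w) \<in> parcs G" "(w, v) \<in> parcs G" "u \<noteq> v"
  shows "d u v = (if (u, v) \<in> parcs G then 1 else 2)"
  using gdist_triangle[of u w v] gdist_not_adjacent[of u v] gdist_adjacent assms
  by (force dest: wellformed')

section \<open>Cut sums and inner sums\<close>

definition cut_sum :: "'a set \<Rightarrow> real" where
  "cut_sum S = (\<Sum>u\<in>S. \<Sum>v\<in>V - S. d u v)"

definition inner_sum :: "'a set \<Rightarrow> real" where
  "inner_sum S = (\<Sum>u\<in>S. \<Sum>v\<in>S. d u v)"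

lemma gdist_nonneg: "u \<in> V \<Longrightarrow> v \<in> V \<Longrightarrow> 0 \<le> d u v"
  using gdist_ge_1[of u v] gdist_self[of u] by (cases "u = v") auto

lemma finite_V: "finite V"
  by simp

lemma finite_subset_V: "S \<subseteq> V \<Longrightarrow> finite S"
  using finite_V finite_subset by blast

lemma cut_complement:
  assumes "S \<subseteq> V" shows "cut_sum (V - S) = cut_sum S"
proof -
  have "V - (V - S) = S" using assms by auto
  then show ?thesis
    unfolding cut_sum_def by (subst sum.swap) (use assms in \<open>auto intro!: sum.cong gdist_sym\<close>)
qed

lemma vol_eq:
  assumes "S \<subseteq> V" shows "vol G S = cut_sum S + inner_sum S"
  unfolding vol_def transmission_def cut_sum_def inner_sum_def sum.subset_diff[OF assms finite_V]
  by (simp add: sum.distrib)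

text \<open>By symmetry of the distance both volumes contain the same cut sum, so the minimum only
  compares the inner sums.\<close>

lemma cheeger_ratio_eq:
  assumes "S \<subseteq> V"
  shows "cheeger_ratio G S = cut_sum S / (cut_sum S + min (inner_sum S) (inner_sum (V - S)))"
  using assms unfolding cheeger_ratio_def
  by (simp add: vol_eq cut_complement min_add_distrib_right flip: cut_sum_def)

lemma cheeger_ratio_complement:
  "S \<subseteq> V \<Longrightarrow> cheeger_ratio G (V - S) = cheeger_ratio G S"
  by (simp add: cheeger_ratio_eq cut_complement double_diff min.commute)

lemma inner_nonneg: "S \<subseteq> V \<Longrightarrow> 0 \<le> inner_sum S"
  unfolding inner_sum_def by (intro sum_nonneg gdist_nonneg) auto

lemma cut_pos:
  assumes "S \<noteq> {}" "S \<subset> V" shows "0 < cut_sum S"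
proof -
  have "0 < d u v" if "u \<in> S" "v \<in> V - S" for u v
    using gdist_ge_1[of u v] that assms by force
  then show ?thesis
    unfolding cut_sum_def using assms finite_subset_V by (intro sum_pos) auto
qed

section \<open>Summed triangle inequalities across a cut\<close>

lemma triangle_excess:
  assumes "S \<subseteq> V"
  shows "(\<Sum>u\<in>S. \<Sum>u'\<in>S - {u}. \<Sum>v\<in>V - S. d u v + d u' v - d u u') =
    2 * (real (card S) - 1) * cut_sum S - card (V - S) * inner_sum S"
proof -
  note fin = finite_subset_V[OF assms]
  \<comment> \<open>Restoring the term \<open>u' = u\<close> adds \<open>2 * d u v\<close> for every
    \<open>v\<close>, because \<open>d u u = 0\<close>. This correction is the source of
    \<open>card S - 1\<close> in place of \<open>card S\<close>.\<close>
  have "(\<Sum>u'\<in>S - {u}. \<Sum>v\<in>V - S. d u v + d u' v - d u u') =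
      (\<Sum>u'\<in>S. \<Sum>v\<in>V - S. d u v + d u' v - d u u') - 2 * (\<Sum>v\<in>V - S. d u v)"
    if "u \<in> S" for u
    using that assms by (subst sum.remove[OF fin that]) (auto simp: gdist_self sum_distrib_left)
  then have "(\<Sum>u\<in>S. \<Sum>u'\<in>S - {u}. \<Sum>v\<in>V - S. d u v + d u' v - d u u') =
      (\<Sum>u\<in>S. \<Sum>u'\<in>S. \<Sum>v\<in>V - S. d u v + d u' v - d u u') - 2 * cut_sum S"
    by (simp add: cut_sum_def sum_subtractf sum_distrib_left)
  also have "\<dots> = real (card S) * cut_sum S + real (card S) * cut_sum S - card (V - S) * inner_sum S - 2 * cut_sum S"
    by (simp add: sum_subtractf sum.distrib cut_sum_def inner_sum_def sum_distrib_left)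
  finally show ?thesis by (simp add: algebra_simps)
qed

lemma gdist_triangle_via:
  "u \<in> V \<Longrightarrow> u' \<in> V \<Longrightarrow> v \<in> V \<Longrightarrow> d u u' \<le> d u v + d u' v"
  using gdist_triangle[of u v u'] gdist_sym[of u' v] by simp

lemma inner_le_cut:
  assumes "S \<subseteq> V"
  shows "card (V - S) * inner_sum S \<le> 2 * (real (card S) - 1) * cut_sum S"
proof -
  have "0 \<le> (\<Sum>u\<in>S. \<Sum>u'\<in>S - {u}. \<Sum>v\<in>V - S. d u v + d u' v - d u u')"
    using assms by (intro sum_nonneg) (auto intro: gdist_triangle_via subsetD[OF assms(1)])
  then show ?thesis using triangle_excess[OF assms] by simp
qed

text \<open>Geometrically, every vertex outside \<open>S\<close> lies on a shortest path between any
  two distinct vertices of \<open>S\<close>.\<close>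

definition tight :: "'a set \<Rightarrow> bool" where
  "tight S \<longleftrightarrow> (\<forall>u\<in>S. \<forall>u'\<in>S. \<forall>v\<in>V - S. u \<noteq> u' \<longrightarrow> d u u' = d u v + d u' v)"

text \<open>Equality makes the total excess zero. As all its terms are nonnegative, the three nested
  sums can be peeled off one by one until a single triangle is left with excess zero.\<close>

lemma inner_eq_cut_imp_tight:
  assumes "S \<subseteq> V" "card (V - S) * inner_sum S = 2 * (real (card S) - 1) * cut_sum S"
  shows "tight S"
  unfolding tight_def
proof (intro ballI impI)
  fix u u' v assume uv: "u \<in> S" "u' \<in> S" "v \<in> V - S" "u \<noteq> u'"
  note fin = finite_subset_V[OF assms(1)]
  have nonneg: "0 \<le> d x v + d x' v - d x x'" if "x \<in> S" "x' \<in> S" "v \<in> V - S" for x x' v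
    using that assms(1) gdist_triangle_via[of x x' v] by auto
  have "(\<Sum>u\<in>S. \<Sum>u'\<in>S - {u}. \<Sum>v\<in>V - S. d u v + d u' v - d u u') = 0"
    using triangle_excess assms by simp
  then have "(\<Sum>u'\<in>S - {u}. \<Sum>v\<in>V - S. d u v + d u' v - d u u') = 0"
    by (rule sum_nonneg_0[OF fin _ _ \<open>u \<in> S\<close>, rotated]) (intro sum_nonneg nonneg; simp)
  then have "(\<Sum>v\<in>V - S. d u v + d u' v - d u u') = 0"
    by (rule sum_nonneg_0[of "S - {u}", rotated 2]) (use fin assms uv in \<open>auto intro!: sum_nonneg nonneg simp del: diff_ge_0_iff_ge\<close>)
  then have "d u v + d u' v - d u u' = 0"
    by (rule sum_nonneg_0[of "V - S", rotated 2]) (use assms uv in \<open>auto intro!: nonneg simp del: diff_ge_0_iff_ge\<close>)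
  then show "d u u' = d u v + d u' v" by simp
qed

text \<open>Common neighbours force all distances between distinct vertices of \<open>R\<close> to
  be 1 or 2, so each ordered pair counts 2, less 1 if it is an arc.\<close>

lemma inner_eq_arcs:
  assumes "R \<subseteq> V"
    and "\<And>u v. u \<in> R \<Longrightarrow> v \<in> R \<Longrightarrow> u \<noteq> v \<Longrightarrow> \<exists>w. (u, w) \<in> parcs G \<and> (w, v) \<in> parcs G"
  shows "inner_sum R = 2 * real (card R) * (real (card R) - 1) - card (R \<times> R \<inter> parcs G)"
proof -
  note fin = finite_subset_V[OF assms(1)]
  have *: "d u v = 2 - 2 * of_bool (u = v) - of_bool ((u, v) \<in> parcs G)" if uv: "u \<in> R" "v \<in> R" for u v
  proof (cases "u = v")
    case True
    then show ?thesis using uv assms(1) gdist_self[of u] no_loops'[of u v] by auto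
  next
    case False
    then obtain w where "(u, w) \<in> parcs G" "(w, v) \<in> parcs G" using uv assms(2) by blast
    then show ?thesis using False gdist_common_neighbour by simp
  qed
  have "(\<Sum>v\<in>R. of_bool (u = v)) = (1 :: real)" if "u \<in> R" for u
    using fin that by (simp add: of_bool_def)
  moreover have "(\<Sum>u\<in>R. \<Sum>v\<in>R. of_bool ((u, v) \<in> parcs G)) = (card (R \<times> R \<inter> parcs G) :: real)"
    using fin unfolding sum.cartesian_product
    by (simp only: case_prod_unfold prod.collapse sum_of_bool_eq finite_cartesian_product Collect_mem_eq)
  ultimately show ?thesis
    unfolding inner_sum_def
    by (simp add: * sum_subtractf flip: sum_distrib_left)
qed

section \<open>Balanced bipartitions and extremal joins\<close>

definition small_half :: nat where "small_half = card V div 2"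
definition large_half :: nat where "large_half = card V - card V div 2"

lemma small_half_le: "small_half \<le> large_half"
  and card_V_eq: "card V = small_half + large_half"
  by (auto simp: small_half_def large_half_def)

lemma small_half_pos: "2 \<le> card V \<Longrightarrow> 0 < small_half"
  and large_half_pos: "2 \<le> card V \<Longrightarrow> 0 < large_half"
  by (auto simp: small_half_def large_half_def)

text \<open>With a = \<open>small_half\<close> and b = \<open>large_half\<close>, this makes
  \<open>G\<close> a K(a,b) with arbitrary edges added inside \<open>V - S\<close>. The arcs from
  \<open>V - S\<close> back to \<open>S\<close> come from symmetry.\<close>

definition balanced_join :: "'a set \<Rightarrow> bool" where
  "balanced_join S \<longleftrightarrow> S \<subseteq> V \<and> card S = small_half \<and> S \<times> S \<inter> parcs G = {} \<and> S \<times> (V - S) \<subseteq> parcs G"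

lemma card_complement: "S \<subseteq> V \<Longrightarrow> card (V - S) = card V - card S"
  by (simp add: card_Diff_subset finite_subset_V)

lemma balanced_join_sums:
  assumes S: "balanced_join S" and n: "2 \<le> card V"
  shows "inner_sum S = 2 * real small_half * (real small_half - 1)"
    and "inner_sum (V - S) =
      2 * real large_half * (real large_half - 1) - card ((V - S) \<times> (V - S) \<inter> parcs G)"
    and "cut_sum S = real small_half * real large_half"
proof -
  have sub: "S \<subseteq> V" and card: "card S = small_half" "card (V - S) = large_half"
    and indep: "S \<times> S \<inter> parcs G = {}" and join: "\<And>u v. u \<in> S \<Longrightarrow> v \<in> V - S \<Longrightarrow> (u, v) \<in> parcs G"
    using S by (auto simp: balanced_join_def card_complement card_V_eq)
  have "card S \<noteq> 0" "card (V - S) \<noteq> 0" using card small_half_pos large_half_pos n by auto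
  \<comment> \<open>One vertex of each part serves as the common neighbour of all pairs in the other
    part, as \<open>inner_eq_arcs\<close> requires.\<close>
  then obtain s t where st: "s \<in> S" "t \<in> V - S" by (metis card_eq_0_iff ex_in_conv)
  have "inner_sum S = 2 * real (card S) * (real (card S) - 1) - card (S \<times> S \<inter> parcs G)"
    using st join arcs_symmetric by (intro inner_eq_arcs sub) blast
  then show "inner_sum S = 2 * real small_half * (real small_half - 1)"
    by (simp add: indep card)
  have "inner_sum (V - S) = 2 * real (card (V - S)) * (real (card (V - S)) - 1)
      - card ((V - S) \<times> (V - S) \<inter> parcs G)"
    using st join arcs_symmetric by (intro inner_eq_arcs) blast+
  then show "inner_sum (V - S) =
      2 * real large_half * (real large_half - 1) - card ((V - S) \<times> (V - S) \<inter> parcs G)"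
    by (simp add: card)
  have "cut_sum S = (\<Sum>u\<in>S. \<Sum>v\<in>V - S. 1)"
    unfolding cut_sum_def using join by (intro sum.cong refl gdist_adjacent) auto
  then show "cut_sum S = real small_half * real large_half"
    by (simp add: card)
qed

text \<open>Without arcs inside \<open>V - S\<close> the two inner sums differ by 2b(b-1) - 2a(a-1)
  = 2(b-a)(a+b-1), where a+b = \<open>card V\<close>. Each arc inside \<open>V - S\<close> lowers
  this difference by 1.\<close>

lemma balanced_join_inner_le_iff:
  assumes S: "balanced_join S" and n: "2 \<le> card V"
  shows "inner_sum S \<le> inner_sum (V - S) \<longleftrightarrow>
    card ((V - S) \<times> (V - S) \<inter> parcs G) \<le> 2 * ((large_half - small_half) * (card V - 1))"
proof -
  have "real (large_half - small_half) = real large_half - real small_half"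
    using small_half_le by (rule of_nat_diff)
  moreover have "real (card V - 1) = real small_half + real large_half - 1"
    using n by (simp add: of_nat_diff card_V_eq)
  ultimately have "real (2 * ((large_half - small_half) * (card V - 1))) =
      2 * ((real large_half - real small_half) * (real small_half + real large_half - 1))"
    by (simp only: of_nat_mult of_nat_numeral)
  then have "inner_sum (V - S) - inner_sum S =
      real (2 * ((large_half - small_half) * (card V - 1))) - card ((V - S) \<times> (V - S) \<inter> parcs G)"
    unfolding balanced_join_sums[OF assms] by algebra
  then show ?thesis by linarith
qed

text \<open>One formula for both parities: with n = \<open>card V\<close> it is n/(3n-4) for even n
  and (n+1)/(3n-5) for odd n.\<close>

definition extremal_ratio :: real where
  "extremal_ratio = real large_half / (real large_half + 2 * real small_half - 2)"

lemma balanced_join_ratio: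
  assumes S: "balanced_join S" and n: "2 \<le> card V" and "inner_sum S \<le> inner_sum (V - S)"
  shows "cheeger_ratio G S = extremal_ratio"
proof -
  have sub: "S \<subseteq> V" using S by (simp add: balanced_join_def)
  have pos: "0 < real small_half" using small_half_pos n by simp
  have "cut_sum S + min (inner_sum S) (inner_sum (V - S)) =
      real small_half * (real large_half + 2 * real small_half - 2)"
    unfolding min_absorb1[OF assms(3)] unfolding balanced_join_sums(1,3)[OF S n]
    by (simp add: algebra_simps)
  then have "cheeger_ratio G S = (real small_half * real large_half) /
      (real small_half * (real large_half + 2 * real small_half - 2))"
    unfolding cheeger_ratio_eq[OF sub] by (simp only: balanced_join_sums(3)[OF S n])
  then show ?thesis using pos by (simp add: extremal_ratio_def)
qed

section \<open>The lower bound for a single cut\<close>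

lemma inner_le_cut_small:
  assumes "S \<noteq> {}" "S \<subseteq> V" "card S \<le> small_half" "2 \<le> card V"
  shows "large_half * inner_sum S \<le> 2 * (real small_half - 1) * cut_sum S"
    and "large_half * inner_sum S = 2 * (real small_half - 1) * cut_sum S \<Longrightarrow> card S = small_half"
proof -
  have "S \<noteq> V" using assms small_half_le large_half_pos card_V_eq by auto
  then have "S \<subset> V" using assms by auto
  then have cut: "0 < cut_sum S" using assms cut_pos by simp
  have s: "1 \<le> card S" using assms finite_subset_V by (simp add: Suc_le_eq card_gt_0_iff)
  \<comment> \<open>A smaller \<open>S\<close> has a larger complement and a smaller factor
    \<open>card S - 1\<close>, so replacing the actual sizes by the balanced ones only weakens
    \<open>inner_le_cut\<close>.\<close>
  have "large_half \<le> card (V - S)" using assms by (simp add: card_complement card_V_eq)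
  then have 1: "large_half * inner_sum S \<le> card (V - S) * inner_sum S"
    by (intro mult_right_mono inner_nonneg assms) simp
  have 2: "card (V - S) * inner_sum S \<le> 2 * (real (card S) - 1) * cut_sum S"
    using assms by (intro inner_le_cut)
  have 3: "2 * (real (card S) - 1) * cut_sum S \<le> 2 * (real small_half - 1) * cut_sum S"
    using assms(3) cut by (intro mult_right_mono) auto
  show "large_half * inner_sum S \<le> 2 * (real small_half - 1) * cut_sum S"
    using 1 2 3 by linarith
  assume "large_half * inner_sum S = 2 * (real small_half - 1) * cut_sum S"
  \<comment> \<open>Equality collapses the whole chain. Its last link then determines
    \<open>card S\<close>, because the cut sum is positive.\<close>
  then have "2 * (real (card S) - 1) * cut_sum S = 2 * (real small_half - 1) * cut_sum S"
    using 1 2 3 by linarith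
  then show "card S = small_half" using cut by simp
qed

lemma cheeger_ratio_bound:
  assumes "S \<noteq> {}" "S \<subset> V" "2 \<le> card V"
  shows "extremal_ratio \<le> cheeger_ratio G S"
    and "cheeger_ratio G S = extremal_ratio \<Longrightarrow>
      \<exists>T. T \<noteq> {} \<and> T \<subset> V \<and> card T = small_half \<and> inner_sum T \<le> inner_sum (V - T) \<and>
        large_half * inner_sum T = 2 * (real small_half - 1) * cut_sum T"
proof -
  \<comment> \<open>The ratio is invariant under complementation, so \<open>T\<close> is whichever
    of \<open>S\<close> and \<open>V - S\<close> has at most half of the vertices.\<close>
  obtain T where T: "T \<noteq> {}" "T \<subset> V" "card T \<le> small_half"
    and ratio: "cheeger_ratio G S = cheeger_ratio G T"
  proof (cases "card S \<le> small_half")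
    case True
    then show ?thesis using that assms by blast
  next
    case False
    then have "card (V - S) \<le> small_half"
      using assms by (simp add: card_complement small_half_def)
    then show ?thesis using that[of "V - S"] assms cheeger_ratio_complement[of S] by auto
  qed
  define c where "c = cut_sum T"
  define m where "m = min (inner_sum T) (inner_sum (V - T))"
  have c: "0 < c" using cut_pos T by (simp add: c_def)
  have m: "0 \<le> m" using T by (auto simp: m_def intro!: inner_nonneg)
  \<comment> \<open>The denominator of \<open>extremal_ratio\<close>; it is positive because both
    halves are at least 1.\<close>
  define X where "X = real large_half + 2 * real small_half - 2"
  have L: "0 < X" "0 < real large_half"
    using small_half_pos large_half_pos assms(3) by (auto simp: X_def)
  have bound: "large_half * inner_sum T \<le> 2 * (real small_half - 1) * c"
    unfolding c_def using T assms by (intro inner_le_cut_small) auto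
  have le: "large_half * m \<le> large_half * inner_sum T"
    by (intro mult_left_mono) (auto simp: m_def)
  have rT: "cheeger_ratio G S = c / (c + m)"
    using T by (simp add: ratio cheeger_ratio_eq c_def m_def)
  have r0: "extremal_ratio = large_half / X"
    by (simp add: extremal_ratio_def X_def)
  have "0 < c + m" using c m by simp
  have "large_half * (c + m) \<le> c * X"
    using bound le by (simp add: X_def algebra_simps)
  then show "extremal_ratio \<le> cheeger_ratio G S"
    unfolding rT r0 using L(1) \<open>0 < c + m\<close>
    by (simp add: pos_divide_le_eq pos_le_divide_eq mult.commute)
  assume "cheeger_ratio G S = extremal_ratio"
  then have "c * X = large_half * (c + m)"
    unfolding rT r0 using L(1) \<open>0 < c + m\<close> by (simp add: frac_eq_eq)
  then have "large_half * m = 2 * (real small_half - 1) * c"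
    by (simp add: X_def algebra_simps)
  \<comment> \<open>At the bound, both \<open>bound\<close> and \<open>le\<close> must be
    equalities: the triangle estimate for \<open>T\<close> is sharp, and \<open>T\<close> is a side
    attaining the minimum \<open>m\<close>.\<close>
  then have eq: "large_half * inner_sum T = 2 * (real small_half - 1) * c" "inner_sum T = m"
    using bound le L by auto
  have "card T = small_half"
    using eq(1) T assms by (intro inner_le_cut_small(2)) (auto simp: c_def)
  moreover have "inner_sum T \<le> inner_sum (V - T)"
    using eq(2) unfolding m_def by linarith
  ultimately show "\<exists>T. T \<noteq> {} \<and> T \<subset> V \<and> card T = small_half \<and> inner_sum T \<le> inner_sum (V - T) \<and>
        large_half * inner_sum T = 2 * (real small_half - 1) * cut_sum T"
    using T eq(1) unfolding c_def by blast
qed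

section \<open>Structure of tight cuts\<close>

lemma tight_independent:
  assumes "tight S" "S \<subset> V"
  shows "S \<times> S \<inter> parcs G = {}"
proof -
  obtain v where v: "v \<in> V - S" using assms by auto
  have False if uu: "u \<in> S" "u' \<in> S" "(u, u') \<in> parcs G" for u u'
  proof -
    \<comment> \<open>The ends of an arc are at distance 1, whereas tightness makes their distance
      that of the detour through \<open>v\<close>, which is at least 2.\<close>
    have "d u u' = d u v + d u' v"
      using assms(1) uu v no_loops'[OF uu(3)] by (simp add: tight_def)
    moreover have "1 \<le> d u v" "1 \<le> d u' v"
      using assms(2) uu v by (auto intro!: gdist_ge_1)
    ultimately show False using gdist_adjacent[OF uu(3)] by simp
  qed
  then show ?thesis by auto
qed

text \<open>Since a tight \<open>S\<close> is independent, the first step of a shortest path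
  starting in \<open>S\<close> leaves \<open>S\<close>.\<close>

lemma tight_step:
  assumes "tight S" "S \<subset> V" "u \<in> S" "v \<in> V - S"
  obtains w where "w \<in> V - S" "(u, w) \<in> parcs G" "d w v = d u v - 1"
proof -
  have "u \<in> V" "v \<in> V" "u \<noteq> v" using assms by auto
  then obtain w where w: "(u, w) \<in> parcs G" "d w v = d u v - 1"
    by (rule gdist_step)
  moreover have "w \<in> V - S"
    using tight_independent[OF assms(1,2)] w(1) assms(3) by (auto dest: wellformed')
  ultimately show ?thesis using that by blast
qed

text \<open>If the first step \<open>w\<close> from \<open>u\<close> missed \<open>v\<close>,
  tightness of \<open>V - S\<close> would put \<open>u\<close> on a shortest path from
  \<open>w\<close> to \<open>v\<close> and give \<open>d w v = 1 + d u v\<close>. But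
  \<open>w\<close> is closer to \<open>v\<close> than \<open>u\<close> is.\<close>

lemma tight_both_sides_imp_join:
  assumes "tight S" "tight (V - S)" "S \<subset> V"
  shows "S \<times> (V - S) \<subseteq> parcs G"
proof (intro subrelI)
  fix u v assume "(u, v) \<in> S \<times> (V - S)"
  then have uv: "u \<in> S" "v \<in> V - S" by auto
  then obtain w where w: "w \<in> V - S" "(u, w) \<in> parcs G" "d w v = d u v - 1"
    using tight_step assms by metis
  show "(u, v) \<in> parcs G"
  proof (cases "w = v")
    case False
    have "u \<in> V - (V - S)" using uv assms(3) by auto
    then have "d w v = d w u + d v u"
      using assms(2) False w(1) uv(2) unfolding tight_def by blast
    moreover have "d w u = 1" using w(2) arcs_symmetric gdist_adjacent by blast
    moreover have "d v u = d u v" using uv assms(3) by (intro gdist_sym) auto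
    ultimately show ?thesis using w(3) by simp
  qed (use w in simp)
qed

text \<open>
  For distinct $u, u', u''$ in $S$ the tight triangles give
  $2 d(u,v) = d(u,u') + d(u,u'') - d(u',u'')$, which does not depend on $v$.
\<close>

lemma tight_large_imp_join:
  assumes "tight S" "S \<subset> V" "3 \<le> card S"
  shows "S \<times> (V - S) \<subseteq> parcs G"
proof (intro subrelI)
  fix u v assume "(u, v) \<in> S \<times> (V - S)"
  then have uv: "u \<in> S" "v \<in> V - S" by auto
  then obtain w where w: "w \<in> V - S" "(u, w) \<in> parcs G" "d w v = d u v - 1"
    using tight_step assms by metis
  have "2 \<le> card (S - {u})" using assms uv finite_subset_V by (simp add: card_Diff_singleton)
  then obtain P where "P \<subseteq> S - {u}" "card P = 2" by (meson obtain_subset_with_card_n)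
  then obtain u' u'' where "P = {u', u''}" "u' \<noteq> u''" by (meson card_2_iff)
  then have u: "u' \<in> S" "u'' \<in> S" "u \<noteq> u'" "u \<noteq> u''" "u' \<noteq> u''"
    using \<open>P \<subseteq> S - {u}\<close> by auto
  have t: "d x y = d x z + d y z" if "x \<in> S" "y \<in> S" "x \<noteq> y" "z \<in> V - S" for x y z
    using assms(1) that by (simp add: tight_def)
  have "d u v = d u w"
    using t[of u u' v] t[of u u' w] t[of u u'' v] t[of u u'' w] t[of u' u'' v] t[of u' u'' w]
      u uv w(1) by linarith
  \<comment> \<open>The constant value of the distance from \<open>u\<close> to the other side is 1,
    as seen at the neighbour \<open>w\<close>.\<close>
  then have "d u v = 1" using gdist_adjacent[OF w(2)] by simp
  then show "(u, v) \<in> parcs G" using gdist_not_adjacent[of u v] uv assms(2) by force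
qed

text \<open>If \<open>u\<close> and \<open>w\<close> are not adjacent, the third vertex is the only
  possible neighbour of either, hence adjacent to both.\<close>

lemma dominating_vertex_of_three:
  assumes "card V = 3"
  obtains c where "c \<in> V" "{c} \<times> (V - {c}) \<subseteq> parcs G"
proof -
  obtain u where u: "u \<in> V" using assms by fastforce
  show ?thesis
  proof (cases "{u} \<times> (V - {u}) \<subseteq> parcs G")
    case True
    then show ?thesis using that u by blast
  next
    case False
    then obtain w where w: "w \<in> V" "w \<noteq> u" "(u, w) \<notin> parcs G" by auto
    obtain x where x: "(u, x) \<in> parcs G" using gdist_step u w by metis
    obtain y where y: "(w, y) \<in> parcs G" using gdist_step u w by metis
    have xV: "x \<in> V" "x \<noteq> u" "x \<noteq> w" using x w no_loops' by (auto dest: wellformed')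
    have yV: "y \<in> V" "y \<noteq> u" "y \<noteq> w" using y w no_loops' arcs_symmetric by (auto dest: wellformed')
    have "V = {u, w, x}"
      using u w xV assms by (intro card_subset_eq[symmetric]) auto
    then have "{x} \<times> (V - {x}) \<subseteq> parcs G" using x y yV arcs_symmetric by auto
    then show ?thesis using that xV by blast
  qed
qed

text \<open>For even order both sides are tight; for odd order from 7 on, \<open>T\<close> has at
  least three vertices. Order 3 gives a singleton \<open>T\<close>, for which tightness is vacuous.
  At order 5 the set \<open>T\<close> has just two vertices, and neither argument for a join
  applies.\<close>

lemma extremal_imp_balanced_join:
  assumes "2 \<le> card V" "card V \<noteq> 5" "S \<noteq> {}" "S \<subset> V" "cheeger_ratio G S = extremal_ratio"
  shows "\<exists>T. balanced_join T \<and> inner_sum T \<le> inner_sum (V - T)"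
proof (cases "card V = 3")
  case True
  then obtain c where c: "c \<in> V" "{c} \<times> (V - {c}) \<subseteq> parcs G" by (rule dominating_vertex_of_three)
  have "small_half = 1" using True by (simp add: small_half_def)
  then have "balanced_join {c}"
    using c no_loops' by (auto simp: balanced_join_def)
  moreover have "inner_sum {c} \<le> inner_sum (V - {c})"
  proof -
    have "inner_sum {c} = 0" using c by (simp add: inner_sum_def gdist_self)
    moreover have "0 \<le> inner_sum (V - {c})" by (rule inner_nonneg) auto
    ultimately show ?thesis by simp
  qed
  ultimately show ?thesis by blast
next
  case False
  obtain T where T: "T \<noteq> {}" "T \<subset> V" "card T = small_half" "inner_sum T \<le> inner_sum (V - T)"
    and eq: "large_half * inner_sum T = 2 * (real small_half - 1) * cut_sum T"
    using cheeger_ratio_bound(2)[OF assms(3,4,1,5)] by blast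
  have card_compl: "card (V - T) = large_half"
    using T by (simp add: card_complement card_V_eq)
  have tight: "tight T"
    using T(2,3) eq card_compl by (intro inner_eq_cut_imp_tight) auto
  have "T \<times> (V - T) \<subseteq> parcs G"
  proof (cases "even (card V)")
    case True
    then have half: "large_half = small_half" by (auto simp: large_half_def small_half_def)
    have compl: "V - T \<noteq> {}" "V - T \<subseteq> V" "V - (V - T) = T" using T by auto
    \<comment> \<open>The complement has the same size and the same cut sum, hence the same upper
      bound on its inner sum. As \<open>T\<close> attains this bound with the smaller inner sum, so
      does \<open>V - T\<close>.\<close>
    have "large_half * inner_sum (V - T) \<le> 2 * (real small_half - 1) * cut_sum (V - T)"
      using compl assms card_compl half by (intro inner_le_cut_small) auto
    moreover have "cut_sum (V - T) = cut_sum T" using T by (simp add: cut_complement)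
    moreover have "large_half * inner_sum T \<le> large_half * inner_sum (V - T)"
      using T(4) by (intro mult_left_mono) auto
    ultimately have "large_half * inner_sum (V - T) = 2 * (real small_half - 1) * cut_sum (V - T)"
      using eq by simp
    then have "tight (V - T)"
      using compl T(3) card_compl half by (intro inner_eq_cut_imp_tight) auto
    then show ?thesis using tight_both_sides_imp_join tight T(2) by blast
  next
    case odd: False
    \<comment> \<open>An odd order other than 3 and 5 is at least 7, and half of it, rounded down,
      is at least 3.\<close>
    then have "3 \<le> card T" using T(3) assms(1,2) False unfolding small_half_def by presburger
    then show ?thesis using tight_large_imp_join tight T(2) by blast
  qed
  then have "balanced_join T"
    using T tight_independent[OF tight] by (auto simp: balanced_join_def)
  then show ?thesis using T(4) by blast
qed

section \<open>The minimum over all cuts\<close>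

lemma cheeger_constant_in_ratios:
  assumes "2 \<le> card V"
  shows "cheeger_constant G \<in> cheeger_ratio G ` {S. S \<noteq> {} \<and> S \<subset> V}"
proof -
  obtain v where "v \<in> V" using assms by fastforce
  moreover have "V \<noteq> {v}" using assms by auto
  ultimately have "{v} \<in> {S. S \<noteq> {} \<and> S \<subset> V}" by auto
  moreover have "finite {S. S \<noteq> {} \<and> S \<subset> V}"
    by (rule finite_subset[of _ "Pow V"]) auto
  ultimately show ?thesis
    unfolding cheeger_constant_def by (intro Min_in finite_imageI) blast+
qed

lemma cheeger_constant_ge:
  assumes "2 \<le> card V" shows "extremal_ratio \<le> cheeger_constant G"
proof -
  obtain S where "S \<noteq> {}" "S \<subset> V" "cheeger_constant G = cheeger_ratio G S"
    using cheeger_constant_in_ratios[OF assms] by (elim imageE) auto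
  then show ?thesis using cheeger_ratio_bound(1) assms by simp
qed

lemma cheeger_constant_le:
  assumes "S \<noteq> {}" "S \<subset> V" shows "cheeger_constant G \<le> cheeger_ratio G S"
proof -
  have "finite {S. S \<noteq> {} \<and> S \<subset> V}"
    by (rule finite_subset[of _ "Pow V"]) auto
  then show ?thesis
    unfolding cheeger_constant_def using assms by (intro Min_le finite_imageI imageI) auto
qed

text \<open>By \<open>balanced_join_inner_le_iff\<close> the arc count says that \<open>S\<close>
  has the smaller inner sum, which is what \<open>balanced_join_ratio\<close> asks for. Conversely,
  a minimising cut yields such a join.\<close>

lemma cheeger_constant_eq_iff:
  assumes "2 \<le> card V" "card V \<noteq> 5"
  shows "cheeger_constant G = extremal_ratio \<longleftrightarrow>
    (\<exists>S. balanced_join S \<and>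
      card ((V - S) \<times> (V - S) \<inter> parcs G) \<le> 2 * ((large_half - small_half) * (card V - 1)))"
    (is "?L \<longleftrightarrow> ?R")
proof
  assume ?L
  obtain S where "S \<noteq> {}" "S \<subset> V" "cheeger_constant G = cheeger_ratio G S"
    using cheeger_constant_in_ratios[OF assms(1)] by (elim imageE) auto
  then show ?R
    using \<open>?L\<close> extremal_imp_balanced_join[OF assms] balanced_join_inner_le_iff[OF _ assms(1)]
    by (metis (no_types, lifting))
next
  assume ?R
  then obtain S where S: "balanced_join S" "inner_sum S \<le> inner_sum (V - S)"
    using balanced_join_inner_le_iff[OF _ assms(1)] by blast
  have "card S = small_half" "S \<subseteq> V" using S by (auto simp: balanced_join_def)
  then have "S \<noteq> {}" "S \<subset> V"
    using small_half_pos[OF assms(1)] large_half_pos[OF assms(1)] card_V_eq by auto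
  then show ?L
    using balanced_join_ratio[OF S(1) assms(1) S(2)] cheeger_constant_ge[OF assms(1)]
      cheeger_constant_le[of S] by simp
qed

text \<open>Instance of \<open>isomorphic_join_iff\<close> in which the number of added edges is at
  most (b-a)(n-1), where n = \<open>card V\<close>: this is 0 for even n and n-1 for odd n.\<close>

lemma cheeger_constant_eq_iff_isomorphic:
  assumes "2 \<le> card V" "card V \<noteq> 5"
  shows "cheeger_constant G = extremal_ratio \<longleftrightarrow>
    (\<exists>F. F \<subseteq> {e. e \<subseteq> Inr ` {..<large_half} \<and> card e = 2} \<and>
      card F \<le> (large_half - small_half) * (card V - 1) \<and>
      isomorphic G (add_edges (complete_bipartite small_half large_half) F))"
proof -
  have "card (V - S) = large_half" if "S \<subseteq> V" "card S = small_half" for S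
    using that by (simp add: card_complement card_V_eq)
  then show ?thesis
    unfolding cheeger_constant_eq_iff[OF assms] isomorphic_join_iff[OF pair_graph] balanced_join_def
    by blast
qed

end

section \<open>Bounds and extremal graphs by parity of the order\<close>

theorem theorem1p1:
  fixes G :: "'a pair_pre_digraph" and n :: nat
  assumes "pair_graph G"
    and "Digraph_Component.connected (with_proj G)"
    and "n = card (pverts G)"
    and "n \<ge> 2"
  shows "(even n \<longrightarrow>
            cheeger_constant G \<ge> real n / (3 * real n - 4) \<and>
            (cheeger_constant G = real n / (3 * real n - 4) \<longleftrightarrow>
               isomorphic G (complete_bipartite (n div 2) (n div 2)))) \<and>
         (odd n \<longrightarrow>
            cheeger_constant G \<ge> (real n + 1) / (3 * real n - 5) \<and>
            (n \<noteq> 5 \<longrightarrow>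
               (cheeger_constant G = (real n + 1) / (3 * real n - 5) \<longleftrightarrow>
                  (\<exists>F. F \<subseteq> {e. e \<subseteq> Inr ` {..<(n + 1) div 2} \<and> card e = 2} \<and>
                       card F \<le> n - 1 \<and>
                       isomorphic G
                         (add_edges (complete_bipartite (n div 2) ((n + 1) div 2)) F)))))"
proof -
  interpret connected_pair_graph G
    using assms(1,2) by (simp add: connected_pair_graph_def connected_pair_graph_axioms_def)
  have n: "2 \<le> card (pverts G)" using assms by simp
  show ?thesis
  proof (intro conjI impI)
    assume "even n"
    then obtain m where m: "n = 2 * m" by blast
    then have half: "small_half = m" "large_half = m"
      unfolding small_half_def large_half_def assms(3)[symmetric] by auto
    have ratio: "extremal_ratio = real n / (3 * real n - 4)"
    proof -
      \<comment> \<open>Doubling numerator and denominator expresses the ratio through n instead of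
        its half.\<close>
      have "real n / (3 * real n - 4) = (2 * real m) / (2 * (3 * real m - 2))" by (simp add: m)
      then show ?thesis by (simp only: extremal_ratio_def half mult_divide_mult_cancel_left_if) simp
    qed
    show "cheeger_constant G \<ge> real n / (3 * real n - 4)"
      using cheeger_constant_ge[OF n] by (simp add: ratio)
    have "card (pverts G) \<noteq> 5" using \<open>even n\<close> assms(3) by presburger
    from cheeger_constant_eq_iff_isomorphic[OF n this]
    have "cheeger_constant G = extremal_ratio \<longleftrightarrow>
      (\<exists>F. F \<subseteq> {e. e \<subseteq> Inr ` {..<m} \<and> card e = 2} \<and> card F = 0 \<and>
        isomorphic G (add_edges (complete_bipartite m m) F))"
      by (simp add: half)
    also have "\<dots> \<longleftrightarrow> isomorphic G (add_edges (complete_bipartite m m) {})"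
    proof -
      have "F \<subseteq> {e. e \<subseteq> Inr ` {..<m} \<and> card e = 2} \<and> card F = 0 \<longleftrightarrow> F = {}"
        for F :: "(nat + nat) set set"
      proof
        assume F: "F \<subseteq> {e. e \<subseteq> Inr ` {..<m} \<and> card e = 2} \<and> card F = 0"
        \<comment> \<open>Infinite sets also have \<open>card\<close> 0, so finiteness must come
          first.\<close>
        have "finite F" by (rule finite_subset[of _ "Pow (Inr ` {..<m})"]) (use F in auto)
        then show "F = {}" using F by simp
      qed simp
      then show ?thesis by (simp only: conj_assoc[symmetric]) simp
    qed
    also have "add_edges (complete_bipartite m m) {} = complete_bipartite m m"
      by (simp add: add_edges_def)
    finally show "cheeger_constant G = real n / (3 * real n - 4) \<longleftrightarrow>
        isomorphic G (complete_bipartite (n div 2) (n div 2))"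
      by (simp add: ratio m)
  next
    assume "odd n"
    then obtain m where m: "n = 2 * m + 1" by (elim oddE)
    \<comment> \<open>The parts differ by one vertex, which turns the allowance (b-a)(n-1) into n-1
      edges.\<close>
    then have half: "small_half = n div 2" "large_half = (n + 1) div 2" "large_half - small_half = 1"
      unfolding small_half_def large_half_def assms(3)[symmetric] by auto
    have ratio: "extremal_ratio = (real n + 1) / (3 * real n - 5)"
    proof -
      have "(real n + 1) / (3 * real n - 5) = (2 * (real m + 1)) / (2 * (3 * real m - 1))"
        by (simp add: m)
      then show ?thesis
        by (simp only: extremal_ratio_def half mult_divide_mult_cancel_left_if) (simp add: m)
    qed
    show "cheeger_constant G \<ge> (real n + 1) / (3 * real n - 5)"
      using cheeger_constant_ge[OF n] by (simp add: ratio)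
    assume "n \<noteq> 5"
    then have "card (pverts G) \<noteq> 5" using assms(3) by simp
    from cheeger_constant_eq_iff_isomorphic[OF n this]
    show "cheeger_constant G = (real n + 1) / (3 * real n - 5) \<longleftrightarrow>
        (\<exists>F. F \<subseteq> {e. e \<subseteq> Inr ` {..<(n + 1) div 2} \<and> card e = 2} \<and> card F \<le> n - 1 \<and>
          isomorphic G (add_edges (complete_bipartite (n div 2) ((n + 1) div 2)) F))"
      unfolding ratio half(3) unfolding half assms(3)[symmetric] by simp
  qed
qed

end
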